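(* Let $V,W$ be Banach spaces, let $\mathcal M$ be a $C^1$ map from an open subset of $V$ to $W$, and let $u_0$ be a point of its domain with $\mathcal M(u_0)=0$. Let $L=d\mathcal M_{u_0}:V\to W$ and $V_0=\ker L$, and suppose $V=V_0\oplus V_1$ for a closed subspace $V_1\subset V$. Suppose also that the image $W_1=\operatorname{Im}L$ is closed and that $W=W_0\oplus W_1$ for a closed subspace $W_0\subset W$. Write $\mathcal M(u)=\mathcal M_0(u)\oplus\mathcal M_1(u)\in W_0\oplus W_1$. Then $u_0$ has integrable deformations in $V$ if and only if, for each $\varepsilon>0$, there exists $\delta>0$ such that $$|\mathcal M_0(u)|\le\varepsilon|\mathcal M(u)|$$ for all $u\in B_\delta(u_0)$.
   Context: Let $S=\{u:\mathcal M(u)=0\}\subset V$ and let $\pi_0:V=V_0\oplus V_1\to V_0$ be the projection. The solution $u_0\in S$ is said to have integrable deformations in $V$ if there exists a $C^1$ map $\sigma$ from a neighborhood of the origin $0\in V_0$ onto a neighborhood of $u_0$ in $S$ such that $\sigma(0)=u_0$ and $(\pi_0\circ d\sigma)_0=\mathbf 1:V_0\to V_0$. $B_\delta(u_0)$ is the open ball in $V$, and $|\cdot|$ denotes the Banach norm. *)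

theory Defs
  imports "HOL-Analysis.Analysis"
begin

text \<open>Algebraic direct sum of two linear subspaces, filling the whole space. Closedness of the
  summands is not included.\<close>

definition direct_sum_decomp :: "'a::real_vector set \<Rightarrow> 'a set \<Rightarrow> bool" where
  "direct_sum_decomp E F \<longleftrightarrow>
     subspace E \<and> subspace F \<and> E \<inter> F = {0} \<and> {x + y | x y. x \<in> E \<and> y \<in> F} = UNIV"

text \<open>Projection onto \<open>E\<close> along \<open>F\<close>; meaningful when \<open>direct_sum_decomp E F\<close>.\<close>

definition proj_along :: "'a::real_vector set \<Rightarrow> 'a set \<Rightarrow> 'a \<Rightarrow> 'a" where
  "proj_along E F v = (THE x. x \<in> E \<and> v - x \<in> F)"

lemma proj_along_unique:
  assumes "direct_sum_decomp E F" "x \<in> E" "v - x \<in> F"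
  shows "proj_along E F v = x"
  unfolding proj_along_def
proof (rule the_equality)
  show "x \<in> E \<and> v - x \<in> F" using assms by simp
next
  fix y assume y: "y \<in> E \<and> v - y \<in> F"
  have E: "subspace E" and F: "subspace F" and I: "E \<inter> F = {0}"
    using assms(1) by (auto simp: direct_sum_decomp_def)
  have "y - x \<in> E" using E y assms(2) by (simp add: subspace_diff)
  moreover have "(v - x) - (v - y) \<in> F" using F y assms(3) by (blast intro: subspace_diff)
  hence "y - x \<in> F" by simp
  ultimately have "y - x = 0" using I by blast
  thus "y = x" by simp
qed

lemma proj_along_add:
  assumes "direct_sum_decomp E F" "x \<in> E" "y \<in> F"
  shows "proj_along E F (x + y) = x"
  using assms by (intro proj_along_unique) auto

text \<open>Continuous differentiability, with continuity of the derivative in the operator norm.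
  The set \<open>A\<close> is either open in the space or relatively open in a closed subspace \<open>E\<close> that has
  a closed complement. In the second case only the values of the derivative on \<open>E\<close> are
  determined by \<open>f\<close>. Asking for a bounded operator on the whole space is no restriction there:
  an operator defined on \<open>E\<close> extends by composition with the (bounded) projection onto \<open>E\<close>,
  and this extension preserves continuity in the base point.\<close>

definition C1_on :: "'a::real_normed_vector set \<Rightarrow> ('a \<Rightarrow> 'b::real_normed_vector) \<Rightarrow> bool" where
  "C1_on A f \<longleftrightarrow>
     (\<exists>D :: 'a \<Rightarrow> 'a \<Rightarrow>\<^sub>L 'b.
        (\<forall>x\<in>A. (f has_derivative blinfun_apply (D x)) (at x within A)) \<and> continuous_on A D)"

text \<open>\<open>S\<close> is the solution set, \<open>V0\<close> the kernel of the linearization at \<open>u0\<close>, and \<open>V1\<close> its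
  complement. \<open>D\<close> is the differential of \<open>\<sigma>\<close> at the origin. The image of \<open>\<sigma>\<close> is a neighbourhood
  of \<open>u0\<close> in \<open>S\<close> in the sense of containing a relatively open one.\<close>

definition integrable_deformations ::
  "'a::real_normed_vector set \<Rightarrow> 'a set \<Rightarrow> 'a set \<Rightarrow> 'a \<Rightarrow> bool" where
  "integrable_deformations S V0 V1 u0 \<longleftrightarrow>
     (\<exists>A \<sigma> D.
        openin (top_of_set V0) A \<and> 0 \<in> A \<and> C1_on A \<sigma> \<and>
        \<sigma> ` A \<subseteq> S \<and>
        (\<exists>N. openin (top_of_set S) N \<and> u0 \<in> N \<and> N \<subseteq> \<sigma> ` A) \<and>
        \<sigma> 0 = u0 \<and>
        (\<sigma> has_derivative D) (at 0 within A) \<and>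
        (\<forall>v\<in>V0. proj_along V0 V1 (D v) = v))"

end

theory Submission
  imports Defs
begin

text \<open>
  Write \<open>p\<close> for the projection onto \<open>V0\<close> along \<open>V1\<close> and \<open>q\<close> for the projection onto \<open>W0\<close> along
  \<open>W1\<close>. Since \<open>V1\<close> and \<open>W1 = L V1\<close> are closed, the open mapping theorem makes \<open>p\<close> and \<open>q\<close> bounded
  and gives \<open>L\<close> a bounded partial inverse \<open>R\<close>: it kills \<open>W0\<close>, inverts \<open>L\<close> as a map from \<open>V1\<close> onto
  \<open>W1\<close>, and so satisfies \<open>R (L v) = v - p v\<close>
  (\<open>bounded_linear_proj_along\<close>, \<open>bounded_partial_inverse\<close>).

  If the estimate holds, then with \<open>\<epsilon> = 1/2\<close> it says that near \<open>u0\<close> the equation \<open>R (M u) = 0\<close>, which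
  means that \<open>M u\<close> lies in \<open>W0\<close>, already forces \<open>M u = 0\<close>. The map \<open>G u = p (u - u0) + R (M u)\<close> has
  the identity as its derivative at \<open>u0\<close>, so it has a local \<open>C1\<close> inverse. Near \<open>u0\<close> the solutions are
  exactly the points that \<open>G\<close> sends into \<open>V0\<close>, and the inverse of \<open>G\<close> restricted to \<open>V0\<close> is the
  required deformation (\<open>integrable_deformations_of_estimate\<close>).

  Conversely, let \<open>\<sigma>\<close> be a deformation. The map \<open>v \<mapsto> p (\<sigma> v - u0)\<close> has the identity of \<open>V0\<close> as its
  derivative at the origin and hence is onto a neighbourhood of the origin in \<open>V0\<close>; thus every \<open>u\<close> near
  \<open>u0\<close> has a solution \<open>s\<close> near \<open>u0\<close> with \<open>u - s\<close> in \<open>V1\<close>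
  (\<open>integrable_deformations_solution_over_kernel\<close>). Strict differentiability compares \<open>M u = M u - M s\<close>
  with \<open>L (u - s)\<close>. The \<open>W0\<close> component of the latter vanishes, so \<open>q (M u)\<close> is small compared with
  \<open>u - s\<close>, while \<open>u - s = R (L (u - s))\<close> is bounded by a multiple of \<open>M u\<close>
  (\<open>estimate_of_integrable_deformations\<close>).

  Both directions need an inverse function theorem in a Banach space, and only for maps of the whole
  space whose derivative is the identity. Subspaces as domains are avoided by completing a map between
  them with the complementary projection.
\<close>

section \<open>Banach's open mapping bound on a closed subspace\<close>

text \<open>The Baire half of the open mapping theorem. The image of \<open>E\<close> is complete and is the union of
  the closures of the images of balls, so one of these closures contains a relative ball. Convexity and
  symmetry move that ball to the origin, and scaling turns it into approximate solvability of
  \<open>T x = y\<close> with linear control of \<open>x\<close>.\<close>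

lemma closed_subspace_range_approximation:
  fixes T :: "'a::real_normed_vector \<Rightarrow> 'b::banach"
  assumes T: "bounded_linear T" and E: "subspace E" and cl: "closed (T ` E)"
  obtains C where "C > 0"
    "\<And>y. y \<in> T ` E \<Longrightarrow> \<exists>x\<in>E. norm x \<le> C * norm y \<and> norm (y - T x) \<le> norm y / 2"
proof -
  interpret T: bounded_linear T by (rule T)
  define K where "K n = closure (T ` (E \<inter> cball 0 (real n)))" for n
  have subY: "subspace (T ` E)"
    using E T.linear_axioms by (rule linear_subspace_image[rotated])
  have KY: "K n \<subseteq> T ` E" for n
    unfolding K_def using cl by (intro closure_minimal) auto
  have Y_sub: "T ` E \<subseteq> (\<Union>n. K n)"
  proof
    fix y assume "y \<in> T ` E"
    then obtain x where x: "x \<in> E" "y = T x" by auto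
    obtain n where "norm x \<le> real n" using real_arch_simple by blast
    then have "y \<in> T ` (E \<inter> cball 0 (real n))" using x by auto
    then show "y \<in> (\<Union>n. K n)"
      unfolding K_def by (meson UN_I UNIV_I closure_subset subsetD)
  qed
  have Un: "\<Union>(range K) = T ` E" using KY Y_sub by blast
  have "\<exists>n. top_of_set (T ` E) interior_of K n \<noteq> {}"
  proof (rule ccontr)
    assume "\<not> ?thesis"
    then have "top_of_set (T ` E) interior_of \<Union>(range K) = {}"
    proof (intro Baire_category_alt)
      show "completely_metrizable_space (top_of_set (T ` E)) \<or>
        locally_compact_space (top_of_set (T ` E)) \<and> regular_space (top_of_set (T ` E))"
        by (rule disjI1, rule completely_metrizable_space_closedin)
          (use cl in \<open>simp_all add: completely_metrizable_space_euclidean flip: closed_closedin\<close>)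
    qed (use KY in \<open>auto simp: K_def closed_subset\<close>)
    moreover have "top_of_set (T ` E) interior_of (T ` E) = T ` E"
      by (metis interior_of_topspace topspace_euclidean_subtopology)
    moreover have "T 0 \<in> T ` E" using E subspace_0 by blast
    ultimately show False unfolding Un by auto
  qed
  then obtain n y0 where y0: "y0 \<in> top_of_set (T ` E) interior_of K n" by blast
  then obtain e where e: "e > 0" "ball y0 e \<inter> T ` E \<subseteq> K n" and y0Y: "y0 \<in> T ` E"
    unfolding interior_of_def openin_contains_ball by blast
  have conv: "convex (K n)"
    unfolding K_def using E T.linear_axioms
    by (intro convex_closure convex_linear_image convex_Int subspace_imp_convex convex_cball)
  have symm: "- z \<in> K n" if "z \<in> K n" for z
  proof -
    have "uminus ` (T ` (E \<inter> cball 0 (real n))) \<subseteq> T ` (E \<inter> cball 0 (real n))"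
    proof clarify
      fix x assume "x \<in> E" "x \<in> cball 0 (real n)"
      then show "- T x \<in> T ` (E \<inter> cball 0 (real n))"
        using E by (intro image_eqI[of _ _ "- x"]) (auto simp: linear_neg[OF T.linear_axioms] subspace_neg)
    qed
    moreover have "uminus ` K n \<subseteq> closure (uminus ` (T ` (E \<inter> cball 0 (real n))))"
      unfolding K_def
      by (intro closure_bounded_linear_image_subset bounded_linear_minus bounded_linear_ident)
    ultimately have "uminus ` K n \<subseteq> K n"
      unfolding K_def using closure_mono by blast
    then show ?thesis using that by blast
  qed
  \<comment> \<open>averaging \<open>y0 + y\<close> with the reflection of \<open>y0 - y\<close> moves the ball to the origin\<close>
  have ball0: "y \<in> K n" if y: "y \<in> T ` E" "norm y < e" for y
  proof -
    have "y0 + y \<in> ball y0 e \<inter> T ` E" "y0 - y \<in> ball y0 e \<inter> T ` E"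
      using y y0Y subY by (auto simp: dist_norm subspace_add subspace_diff)
    then have "y0 + y \<in> K n" "y0 - y \<in> K n" using e by blast+
    moreover from this have "y - y0 \<in> K n" using symm[of "y0 - y"] by simp
    ultimately have "(1/2) *\<^sub>R (y0 + y) + (1/2) *\<^sub>R (y - y0) \<in> K n"
      using conv by (intro convexD) auto
    then show ?thesis by (simp add: algebra_simps flip: scaleR_add_left)
  qed
  have "\<exists>x\<in>E. norm x \<le> 2 * (real n + 1) / e * norm y \<and> norm (y - T x) \<le> norm y / 2"
    if y: "y \<in> T ` E" for y
  proof (cases "y = 0")
    case True
    then show ?thesis using E by (intro bexI[of _ 0]) (auto simp: T.zero subspace_0)
  next
    case False
    \<comment> \<open>\<open>t y\<close> has norm \<open>e / 2\<close>, so an approximation of it up to \<open>e / 4\<close> has relative error one half\<close>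
    define t where "t = e / (2 * norm y)"
    have t: "t > 0" using e False by (simp add: t_def)
    have "norm (t *\<^sub>R y) < e" using e False by (simp add: t_def)
    then have "t *\<^sub>R y \<in> K n"
      using y subY by (intro ball0) (auto simp: subspace_scale)
    then obtain z where z: "z \<in> E" "norm z \<le> n" "dist (T z) (t *\<^sub>R y) < e/4"
      using e(1) unfolding K_def closure_approachable by (force dest: spec[of _ "e/4"])
    show ?thesis
    proof (intro bexI conjI)
      show "(1/t) *\<^sub>R z \<in> E" using z E by (simp add: subspace_scale)
      have "norm ((1/t) *\<^sub>R z) \<le> (1/t) * (real n + 1)"
        using z t by (simp add: divide_right_mono)
      also have "\<dots> = 2 * (real n + 1) / e * norm y"
        using e False by (simp add: t_def field_simps)
      finally show "norm ((1/t) *\<^sub>R z) \<le> 2 * (real n + 1) / e * norm y" .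
      have "y - T ((1/t) *\<^sub>R z) = (1/t) *\<^sub>R (t *\<^sub>R y - T z)"
        using t by (simp add: T.scaleR algebra_simps)
      then have "norm (y - T ((1/t) *\<^sub>R z)) = (1/t) * norm (t *\<^sub>R y - T z)"
        using t by simp
      also have "\<dots> \<le> (1/t) * (e/4)"
        using z t by (intro mult_left_mono) (auto simp: dist_norm norm_minus_commute)
      also have "\<dots> = norm y / 2" using e False by (simp add: t_def field_simps)
      finally show "norm (y - T ((1/t) *\<^sub>R z)) \<le> norm y / 2" .
    qed
  qed
  moreover have "2 * (real n + 1) / e > 0" using e by simp
  ultimately show thesis using that by blast
qed

text \<open>The completeness half of the open mapping theorem: solving approximately for the successive
  residuals halves the error each time, so the corrections form a geometrically convergent series. Its
  sum has the same image as \<open>x\<close>, hence is \<open>x\<close> by injectivity. Stating the theorem as a lower bound on a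
  closed subspace makes it directly usable for sets \<open>E\<close> that are not types.\<close>

lemma bounded_below_on_closed_subspace:
  fixes T :: "'a::banach \<Rightarrow> 'b::banach"
  assumes T: "bounded_linear T" and E: "subspace E" "closed E" and cl: "closed (T ` E)"
    and inj: "\<And>x. x \<in> E \<Longrightarrow> T x = 0 \<Longrightarrow> x = 0"
  obtains c where "c > 0" "\<And>x. x \<in> E \<Longrightarrow> norm x \<le> c * norm (T x)"
proof -
  interpret T: bounded_linear T by (rule T)
  have subY: "subspace (T ` E)"
    using E(1) T.linear_axioms by (rule linear_subspace_image[rotated])
  obtain C where C: "C > 0" and
    ap: "\<And>y. y \<in> T ` E \<Longrightarrow> \<exists>x\<in>E. norm x \<le> C * norm y \<and> norm (y - T x) \<le> norm y / 2"
    using closed_subspace_range_approximation[OF T E(1) cl] by blast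
  obtain a where a: "\<And>y. y \<in> T ` E \<Longrightarrow>
      a y \<in> E \<and> norm (a y) \<le> C * norm y \<and> norm (y - T (a y)) \<le> norm y / 2"
    using ap by metis
  have "norm x \<le> 2 * C * norm (T x)" if x: "x \<in> E" for x
  proof -
    \<comment> \<open>the residual after \<open>k\<close> corrections\<close>
    define r where "r k = ((\<lambda>y. y - T (a y)) ^^ k) (T x)" for k
    have rY: "r k \<in> T ` E" for k
    proof (induction k)
      case (Suc k)
      then show ?case using a subY by (auto simp: r_def intro!: subspace_diff)
    qed (use x in \<open>simp add: r_def\<close>)
    have rn: "norm (r k) \<le> norm (T x) * (1/2) ^ k" for k
    proof (induction k)
      case (Suc k)
      have "norm (r (Suc k)) \<le> norm (r k) / 2" using a[OF rY[of k]] by (simp add: r_def)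
      then show ?case using Suc by simp
    qed (simp add: r_def)
    have an: "norm (a (r k)) \<le> C * norm (T x) * (1/2) ^ k" for k
    proof -
      have "norm (a (r k)) \<le> C * norm (r k)" using a[OF rY[of k]] by simp
      also have "\<dots> \<le> C * (norm (T x) * (1/2) ^ k)"
        using rn C by (intro mult_left_mono) auto
      finally show ?thesis by (simp add: mult.assoc)
    qed
    have geo: "(\<lambda>k. C * norm (T x) * (1/2) ^ k) sums (C * norm (T x) * 2)"
      using geometric_sums[of "1/2::real"] by (intro sums_mult) auto
    have sn: "summable (\<lambda>k. norm (a (r k)))"
    proof (rule summable_comparison_test'[OF sums_summable[OF geo]])
      show "norm (norm (a (r k))) \<le> C * norm (T x) * (1/2) ^ k" if "k \<ge> 0" for k
        using an[of k] by simp
    qed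
    then have sm: "summable (\<lambda>k. a (r k))" by (rule summable_norm_cancel)
    define z where "z = (\<Sum>k. a (r k))"
    have partial: "T (\<Sum>k<m. a (r k)) = T x - r m" for m
      by (induction m) (auto simp: T.zero T.add r_def)
    have lim: "(\<lambda>m. \<Sum>k<m. a (r k)) \<longlonglongrightarrow> z"
      unfolding z_def by (rule summable_LIMSEQ[OF sm])
    have "(\<Sum>k<m. a (r k)) \<in> E" for m
      using a rY E by (intro subspace_sum) auto
    then have "z \<in> E" by (rule closed_sequentially[OF E(2) _ lim])
    have "r \<longlonglongrightarrow> 0"
    proof (rule Lim_null_comparison)
      show "\<forall>\<^sub>F k in sequentially. norm (r k) \<le> norm (T x) * (1/2) ^ k" using rn by simp
      show "(\<lambda>k. norm (T x) * (1/2) ^ k) \<longlonglongrightarrow> 0"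
        by (intro tendsto_mult_right_zero LIMSEQ_power_zero) auto
    qed
    then have "(\<lambda>m. T x - r m) \<longlonglongrightarrow> T x - 0" by (intro tendsto_intros)
    moreover have "(\<lambda>m. T (\<Sum>k<m. a (r k))) \<longlonglongrightarrow> T z"
      by (rule T.tendsto[OF lim])
    ultimately have "T z = T x" unfolding partial using LIMSEQ_unique by fastforce
    then have "x - z = 0"
      using x \<open>z \<in> E\<close> E by (intro inj) (auto simp: T.diff subspace_diff)
    then have "norm x = norm z" by simp
    also have "\<dots> \<le> (\<Sum>k. norm (a (r k)))" unfolding z_def using sn by (rule summable_norm)
    also have "\<dots> \<le> C * norm (T x) * 2"
      by (rule sums_le[OF an summable_sums[OF sn] geo])
    finally show ?thesis by (simp add: mult_ac)
  qed
  with C show thesis by (intro that[of "2 * C"]) auto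
qed

section \<open>Projections and partial inverses of closed splittings\<close>

lemma proj_along_decomp:
  assumes "direct_sum_decomp E F"
  shows proj_along_mem: "proj_along E F v \<in> E"
    and proj_along_compl_mem: "v - proj_along E F v \<in> F"
proof -
  have "v \<in> {x + y | x y. x \<in> E \<and> y \<in> F}"
    using assms by (simp add: direct_sum_decomp_def)
  then obtain x y where "v = x + y" "x \<in> E" "y \<in> F" by blast
  moreover from this have "proj_along E F v = x" using proj_along_add assms by blast
  ultimately show "proj_along E F v \<in> E" "v - proj_along E F v \<in> F" by auto
qed

lemma proj_along_eq_self:
  assumes "direct_sum_decomp E F" "v \<in> E"
  shows "proj_along E F v = v"
  using assms by (intro proj_along_unique) (auto simp: direct_sum_decomp_def subspace_0)

lemma proj_along_eq_0_iff:
  assumes "direct_sum_decomp E F"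
  shows "proj_along E F v = 0 \<longleftrightarrow> v \<in> F"
proof
  assume "proj_along E F v = 0"
  then show "v \<in> F" using proj_along_compl_mem[OF assms, of v] by simp
next
  assume "v \<in> F"
  then show "proj_along E F v = 0"
    using assms by (intro proj_along_unique) (auto simp: direct_sum_decomp_def subspace_0)
qed

text \<open>Addition is injective from the closed subspace \<open>E \<times> F\<close> onto the whole space, so the open mapping
  bound controls both components of a vector by their sum.\<close>

lemma bounded_linear_proj_along:
  fixes E F :: "'a::banach set"
  assumes ds: "direct_sum_decomp E F" and E: "closed E" and F: "closed F"
  shows "bounded_linear (proj_along E F)"
proof -
  have sE: "subspace E" and sF: "subspace F" and EF: "E \<inter> F = {0}"
    using ds by (auto simp: direct_sum_decomp_def)
  have T: "bounded_linear (\<lambda>p::'a \<times> 'a. fst p + snd p)"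
    by (intro bounded_linear_add bounded_linear_fst bounded_linear_snd)
  have "(\<lambda>p. fst p + snd p) ` (E \<times> F) = {x + y | x y. x \<in> E \<and> y \<in> F}"
    by force
  then have surj: "(\<lambda>p. fst p + snd p) ` (E \<times> F) = UNIV"
    using ds by (simp add: direct_sum_decomp_def)
  have inj: "p = 0" if "p \<in> E \<times> F" "fst p + snd p = 0" for p
  proof -
    obtain x y where p: "p = (x, y)" by force
    have "x = - y" using that p by (simp add: add_eq_0_iff2)
    then have "x \<in> E \<inter> F" using that p sF subspace_neg by auto
    then have "x = 0" using EF by blast
    then show ?thesis using \<open>x = - y\<close> p by (simp add: zero_prod_def)
  qed
  obtain c where c: "\<And>p. p \<in> E \<times> F \<Longrightarrow> norm p \<le> c * norm (fst p + snd p)"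
    using bounded_below_on_closed_subspace[OF T subspace_Times[OF sE sF] closed_Times[OF E F] _ inj]
    unfolding surj by (metis closed_UNIV)
  note mem = proj_along_mem[OF ds] proj_along_compl_mem[OF ds]
  show ?thesis
  proof (rule bounded_linear_intro)
    fix x y
    have "(x - proj_along E F x) + (y - proj_along E F y) \<in> F"
      using mem sF by (intro subspace_add)
    then show "proj_along E F (x + y) = proj_along E F x + proj_along E F y"
      using mem sE by (intro proj_along_unique[OF ds] subspace_add) (auto simp: algebra_simps)
  next
    fix t x
    have "t *\<^sub>R (x - proj_along E F x) \<in> F"
      using mem sF by (intro subspace_scale)
    then show "proj_along E F (t *\<^sub>R x) = t *\<^sub>R proj_along E F x"
      using mem sE by (intro proj_along_unique[OF ds] subspace_scale) (auto simp: algebra_simps)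
  next
    fix x
    have "norm (proj_along E F x) \<le> norm (proj_along E F x, x - proj_along E F x)"
      using norm_fst_le by metis
    also have "\<dots> \<le> c * norm x"
      using c[of "(proj_along E F x, x - proj_along E F x)"] mem by simp
    finally show "norm (proj_along E F x) \<le> norm x * c" by (simp add: mult.commute)
  qed
qed

text \<open>\<open>R\<close> takes the range component of \<open>w\<close> to its unique preimage in \<open>V1\<close>. It is bounded because the
  closed subspace \<open>V1\<close> is mapped injectively onto the closed range.\<close>

lemma bounded_partial_inverse:
  fixes L :: "'v::banach \<Rightarrow> 'w::banach"
  assumes L: "bounded_linear L" and V1: "closed V1" and dsV: "direct_sum_decomp {v. L v = 0} V1"
    and cl: "closed (range L)" and W0: "closed W0" and dsW: "direct_sum_decomp W0 (range L)"
  obtains R where "bounded_linear R"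
    "\<And>w. R w \<in> V1" "\<And>w. L (R w) = w - proj_along W0 (range L) w"
    "\<And>v. R (L v) = v - proj_along {v. L v = 0} V1 v"
proof -
  interpret L: bounded_linear L by (rule L)
  interpret Q: bounded_linear "proj_along W0 (range L)"
    by (rule bounded_linear_proj_along[OF dsW W0 cl])
  have sV1: "subspace V1" using dsV by (simp add: direct_sum_decomp_def)
  have inj: "v = 0" if "v \<in> V1" "L v = 0" for v
  proof -
    have "v \<in> {v. L v = 0} \<inter> V1" using that by simp
    then show ?thesis using dsV unfolding direct_sum_decomp_def by simp
  qed
  have inj2: "u = v" if "u \<in> V1" "v \<in> V1" "L u = L v" for u v
    using inj[of "u - v"] that sV1 by (simp add: subspace_diff L.diff)
  have LV1: "L v = L (v - proj_along {v. L v = 0} V1 v)" for v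
    using proj_along_mem[OF dsV, of v] by (simp add: L.diff)
  have img: "L ` V1 = range L"
    using LV1 proj_along_compl_mem[OF dsV] by blast
  obtain c where c: "c > 0" "\<And>x. x \<in> V1 \<Longrightarrow> norm x \<le> c * norm (L x)"
    using bounded_below_on_closed_subspace[OF L sV1 V1 cl[folded img] inj] by blast
  have "\<exists>v\<in>V1. L v = w - proj_along W0 (range L) w" for w
    using proj_along_compl_mem[OF dsW, of w] img by (metis imageE)
  then obtain R where R: "\<And>w. R w \<in> V1" "\<And>w. L (R w) = w - proj_along W0 (range L) w"
    by metis
  have "bounded_linear R"
  proof (rule bounded_linear_intro)
    show "R (x + y) = R x + R y" for x y
      using R sV1 by (intro inj2) (auto simp: subspace_add L.add Q.add)
    show "R (t *\<^sub>R x) = t *\<^sub>R R x" for t x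
      using R sV1 by (intro inj2) (auto simp: subspace_scale L.scaleR Q.scaleR scaleR_diff_right)
    fix w
    have "norm (R w) \<le> c * norm (w - proj_along W0 (range L) w)"
      using c(2)[OF R(1), of w] R(2) by simp
    also have "\<dots> \<le> c * (onorm (\<lambda>w. w - proj_along W0 (range L) w) * norm w)"
      using c(1) by (intro mult_left_mono onorm bounded_linear_sub bounded_linear_ident
          Q.bounded_linear_axioms) auto
    finally show "norm (R w) \<le> norm w * (c * onorm (\<lambda>w. w - proj_along W0 (range L) w))"
      by (simp add: mult_ac)
  qed
  moreover have "R (L v) = v - proj_along {v. L v = 0} V1 v" for v
    using R proj_along_compl_mem[OF dsV] LV1[of v] proj_along_eq_0_iff[OF dsW, of "L v"]
    by (intro inj2) auto
  ultimately show thesis using R that by blast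
qed

section \<open>Strict differentiability and the inverse function theorem\<close>

text \<open>Continuity of the derivative upgrades differentiability at \<open>x0\<close> to strict differentiability: on
  a small ball the derivative of \<open>f - D x0\<close> has norm at most \<open>e\<close>, and the mean value inequality
  applies.\<close>

lemma C1_on_strict_derivative:
  fixes f :: "'a::real_normed_vector \<Rightarrow> 'b::real_normed_vector"
  assumes U: "open U" "x0 \<in> U"
    and D: "\<And>x. x \<in> U \<Longrightarrow> (f has_derivative blinfun_apply (D x)) (at x)"
    and cont: "continuous_on U D" and e: "e > 0"
  obtains r where "r > 0" "ball x0 r \<subseteq> U" "\<And>x. x \<in> ball x0 r \<Longrightarrow> norm (D x - D x0) \<le> e"
    "\<And>x y. x \<in> ball x0 r \<Longrightarrow> y \<in> ball x0 r \<Longrightarrow>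
      norm (f x - f y - D x0 (x - y)) \<le> e * norm (x - y)"
proof -
  obtain r1 where r1: "r1 > 0" "ball x0 r1 \<subseteq> U" using U open_contains_ball by blast
  obtain r2 where r2: "r2 > 0" "\<And>x. x \<in> U \<Longrightarrow> dist x x0 < r2 \<Longrightarrow> dist (D x) (D x0) < e"
    using cont U e unfolding continuous_on_iff by metis
  define r where "r = min r1 r2"
  have sub: "ball x0 r \<subseteq> U" using r1 by (auto simp: r_def)
  have near: "norm (D x - D x0) \<le> e" if "x \<in> ball x0 r" for x
    using that sub r2(2)[of x] by (auto simp: r_def dist_norm norm_minus_commute)
  have "norm (f x - f y - D x0 (x - y)) \<le> e * norm (x - y)"
    if xy: "x \<in> ball x0 r" "y \<in> ball x0 r" for x y
  proof -
    have "norm ((f x - D x0 x) - (f y - D x0 y)) \<le> e * norm (x - y)"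
    proof (rule differentiable_bound[OF convex_ball _ _ xy])
      fix z assume z: "z \<in> ball x0 r"
      have "((\<lambda>z. f z - D x0 z) has_derivative (\<lambda>h. D z h - D x0 h)) (at z)"
        using z sub by (intro has_derivative_diff D blinfun.bounded_linear_right
            bounded_linear.has_derivative[OF _ has_derivative_ident]) auto
      then show "((\<lambda>z. f z - D x0 z) has_derivative blinfun_apply (D z - D x0)) (at z within ball x0 r)"
        by (simp add: has_derivative_at_withinI blinfun.diff_left[abs_def])
      show "onorm (blinfun_apply (D z - D x0)) \<le> e"
        using near[OF z] by (simp add: norm_blinfun.rep_eq)
    qed
    then show ?thesis by (simp add: blinfun.diff_right algebra_simps)
  qed
  with r1 r2 sub near show thesis by (intro that[of r]) (auto simp: r_def)
qed

lemma near_identity_expands: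
  fixes f :: "'a::real_normed_vector \<Rightarrow> 'a"
  assumes "norm (f x - f y - (x - y)) \<le> 1/2 * norm (x - y)"
  shows "norm (x - y) \<le> 2 * norm (f x - f y)"
  using assms norm_triangle_ineq4[of "f x - f y" "f x - f y - (x - y)"] by simp

text \<open>A solution of \<open>f x = y\<close> is a fixed point of \<open>x \<mapsto> x + y - f x\<close>, which contracts by one half.\<close>

lemma near_identity_surj:
  fixes f :: "'a::banach \<Rightarrow> 'a"
  assumes lip: "\<And>x y. x \<in> ball x0 r \<Longrightarrow> y \<in> ball x0 r \<Longrightarrow>
      norm (f x - f y - (x - y)) \<le> 1/2 * norm (x - y)"
    and y: "dist (f x0) y < r/2"
  obtains x where "x \<in> ball x0 r" "f x = y"
proof -
  \<comment> \<open>the contraction moves \<open>x0\<close> by \<open>s / 2\<close>, so it preserves the closed ball of radius \<open>s\<close>\<close>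
  define s where "s = 2 * norm (y - f x0)"
  have s: "0 \<le> s" "s < r" using y by (auto simp: s_def dist_norm norm_minus_commute)
  have sub: "cball x0 s \<subseteq> ball x0 r" using s by auto
  have "\<exists>!x\<in>cball x0 s. x + y - f x = x"
  proof (rule Banach_fix[where c="1/2"])
    show "(\<lambda>x. x + y - f x) ` cball x0 s \<subseteq> cball x0 s"
    proof clarify
      fix x assume x: "x \<in> cball x0 s"
      have x0: "x0 \<in> cball x0 s" using s by simp
      have "norm (x + y - f x - x0) \<le> norm (y - f x0) + norm (f x - f x0 - (x - x0))"
        using norm_triangle_ineq4[of "y - f x0" "f x - f x0 - (x - x0)"]
        by (simp add: algebra_simps)
      also have "\<dots> \<le> s/2 + 1/2 * norm (x - x0)"
        using lip[OF subsetD[OF sub x] subsetD[OF sub x0]] by (simp add: s_def)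
      also have "\<dots> \<le> s" using x by (simp add: dist_norm norm_minus_commute)
      finally show "x + y - f x \<in> cball x0 s" by (simp add: dist_norm norm_minus_commute)
    qed
    fix x z assume "x \<in> cball x0 s" "z \<in> cball x0 s"
    then have "norm (f x - f z - (x - z)) \<le> 1/2 * norm (x - z)" using lip sub by blast
    moreover have "dist (x + y - f x) (z + y - f z) = norm (f x - f z - (x - z))"
      unfolding dist_norm by (subst norm_minus_commute) (simp add: algebra_simps)
    ultimately show "dist (x + y - f x) (z + y - f z) \<le> 1/2 * dist x z"
      by (simp add: dist_norm)
  qed (use s in \<open>auto simp: complete_eq_closed\<close>)
  then obtain x where "x \<in> cball x0 s" "x + y - f x = x" by blast
  with sub show thesis by (intro that[of x]) auto
qed

text \<open>An operator \<open>T\<close> near the identity satisfies the hypothesis of \<open>near_identity_surj\<close> on every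
  ball, which gives surjectivity without a Neumann series.\<close>

lemma blinfun_inverse_near_id:
  fixes T :: "'a::banach \<Rightarrow>\<^sub>L 'a"
  assumes T: "norm (T - id_blinfun) \<le> 1/2"
  obtains S where "T o\<^sub>L S = id_blinfun" "S o\<^sub>L T = id_blinfun" "norm S \<le> 2"
proof -
  have lip: "norm (T x - T y - (x - y)) \<le> 1/2 * norm (x - y)" for x y
  proof -
    have "T x - T y - (x - y) = (T - id_blinfun) (x - y)"
      by (simp add: blinfun.diff_left blinfun.diff_right)
    also have "norm \<dots> \<le> norm (T - id_blinfun) * norm (x - y)" by (rule norm_blinfun)
    also have "\<dots> \<le> 1/2 * norm (x - y)" using T by (intro mult_right_mono) auto
    finally show ?thesis .
  qed
  note expd = near_identity_expands[of T, OF lip]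
  have "\<exists>x. T x = y" for y
  proof -
    have "dist (T 0) y < (2 * norm y + 1) / 2" by (simp add: blinfun.zero_right)
    then show ?thesis using near_identity_surj[of 0 "2 * norm y + 1" T y] lip by metis
  qed
  then obtain s where Ts: "\<And>y. T (s y) = y" by metis
  have inj: "x = y" if "T x = T y" for x y using expd[of x y] that by simp
  have "bounded_linear s"
  proof (rule bounded_linear_intro)
    show "s (x + y) = s x + s y" for x y
      by (rule inj) (simp add: Ts blinfun.add_right)
    show "s (t *\<^sub>R x) = t *\<^sub>R s x" for t x
      by (rule inj) (simp add: Ts blinfun.scaleR_right)
    show "norm (s x) \<le> norm x * 2" for x
      using expd[of "s x" 0] by (simp add: Ts blinfun.zero_right)
  qed
  then have app: "blinfun_apply (Blinfun s) = s" by (rule bounded_linear_Blinfun_apply)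
  show thesis
  proof
    show "T o\<^sub>L Blinfun s = id_blinfun" by (rule blinfun_eqI) (simp add: app Ts)
    show "Blinfun s o\<^sub>L T = id_blinfun" by (rule blinfun_eqI) (simp add: app Ts inj)
    show "norm (Blinfun s) \<le> 2"
      using expd[of "s _" 0] by (intro norm_blinfun_bound) (auto simp: app Ts blinfun.zero_right)
  qed
qed

text \<open>This is the resolvent identity \<open>S - S' = S (T' - T) S'\<close>; it makes inversion of operators
  continuous, as needed for the derivative of an inverse function to be continuous.\<close>

lemma blinfun_inverse_lipschitz:
  fixes S T S' T' :: "'a::real_normed_vector \<Rightarrow>\<^sub>L 'a"
  assumes "S o\<^sub>L T = id_blinfun" "T' o\<^sub>L S' = id_blinfun" "norm S \<le> c" "norm S' \<le> c"
  shows "norm (S - S') \<le> c * c * norm (T - T')"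
proof (rule norm_blinfun_bound)
  have c: "0 \<le> c" using assms(3) norm_ge_zero order_trans by blast
  then show "0 \<le> c * c * norm (T - T')" by simp
  fix x
  have 1: "S (T z) = z" for z using assms(1) by (metis blinfun_apply_blinfun_compose blinfun_apply_id_blinfun)
  have 2: "T' (S' z) = z" for z using assms(2) by (metis blinfun_apply_blinfun_compose blinfun_apply_id_blinfun)
  have "(S - S') x = S ((T' - T) (S' x))"
    by (simp add: blinfun.diff_left blinfun.diff_right 1 2)
  also have "norm \<dots> \<le> c * (norm (T' - T) * (c * norm x))"
    using assms(3,4) c
    by (intro order_trans[OF norm_blinfun] mult_mono) (auto intro!: mult_nonneg_nonneg)
  finally show "norm ((S - S') x) \<le> c * c * norm (T - T') * norm x"
    by (simp add: norm_minus_commute mult_ac)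
qed

text \<open>The inverse function theorem in a Banach space, for a derivative normalised to the identity. On
  a small ball \<open>f\<close> differs from the identity by a map with Lipschitz constant one half, so the local
  inverse exists by contraction and is Lipschitz; its derivative is the inverse of the derivative
  of \<open>f\<close>.\<close>

theorem C1_inverse_function_near_identity:
  fixes f :: "'a::banach \<Rightarrow> 'a"
  assumes U: "open U" "x0 \<in> U"
    and D: "\<And>x. x \<in> U \<Longrightarrow> (f has_derivative blinfun_apply (D x)) (at x)"
    and cont: "continuous_on U D" and D0: "D x0 = id_blinfun"
  obtains X Y g where "open X" "x0 \<in> X" "X \<subseteq> U" "open Y" "f x0 \<in> Y" "homeomorphism X Y f g"
    "C1_on Y g" "(g has_derivative (\<lambda>h. h)) (at (f x0))"
proof -
  obtain r where r: "r > 0" "ball x0 r \<subseteq> U" "\<And>x. x \<in> ball x0 r \<Longrightarrow> norm (D x - D x0) \<le> 1/2"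
    and lip: "\<And>x y. x \<in> ball x0 r \<Longrightarrow> y \<in> ball x0 r \<Longrightarrow>
      norm (f x - f y - (x - y)) \<le> 1/2 * norm (x - y)"
    using C1_on_strict_derivative[OF U D cont, of "1/2"] by (auto simp: D0)
  note expd = near_identity_expands[of f, OF lip]
  define Y where "Y = ball (f x0) (r/2)"
  define X where "X = ball x0 r \<inter> f -` Y"
  have contf: "continuous_on U f"
    using D by (meson continuous_at_imp_continuous_on has_derivative_continuous)
  have oX: "open X"
    unfolding X_def using contf r by (intro continuous_open_preimage) (auto simp: Y_def intro: continuous_on_subset)
  have "\<exists>x\<in>ball x0 r. f x = y" if "y \<in> Y" for y
    using near_identity_surj[of x0 r f y] lip that by (metis Y_def mem_ball)
  then obtain g where gX: "\<And>y. y \<in> Y \<Longrightarrow> g y \<in> ball x0 r" and fg: "\<And>y. y \<in> Y \<Longrightarrow> f (g y) = y"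
    by metis
  have gf: "g (f x) = x" if "x \<in> X" for x
    using expd[of "g (f x)" x] that gX[of "f x"] fg[of "f x"] by (simp add: X_def)
  have contg: "continuous_on Y g"
    unfolding continuous_on_iff
  proof (intro ballI allI impI)
    fix y and e :: real assume y: "y \<in> Y" and e: "e > 0"
    have "dist (g z) (g y) < e" if "z \<in> Y" "dist z y < e/2" for z
      using expd[OF gX[OF that(1)] gX[OF y]] fg that y by (simp add: dist_norm)
    then show "\<exists>d>0. \<forall>z\<in>Y. dist z y < d \<longrightarrow> dist (g z) (g y) < e"
      using e by (intro exI[of _ "e/2"]) auto
  qed
  have hom: "homeomorphism X Y f g"
  proof (rule homeomorphismI)
    show "continuous_on X f" using contf r by (auto simp: X_def intro: continuous_on_subset)
  qed (use contg gX fg gf in \<open>auto simp: X_def\<close>)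
  have "\<exists>S. D x o\<^sub>L S = id_blinfun \<and> S o\<^sub>L D x = id_blinfun \<and> norm S \<le> 2" if "x \<in> ball x0 r" for x
    using blinfun_inverse_near_id[of "D x"] r(3)[OF that] D0 by metis
  then obtain I where I: "\<And>x. x \<in> ball x0 r \<Longrightarrow>
      D x o\<^sub>L I x = id_blinfun \<and> I x o\<^sub>L D x = id_blinfun \<and> norm (I x) \<le> 2"
    by metis
  have derg: "(g has_derivative blinfun_apply (I (g y))) (at y)" if y: "y \<in> Y" for y
  proof (rule has_derivative_inverse_basic[where T=Y and f=f])
    show "(f has_derivative blinfun_apply (D (g y))) (at (g y))" using gX[OF y] r by (intro D) auto
    show "blinfun_apply (I (g y)) \<circ> blinfun_apply (D (g y)) = id"
      using I[OF gX[OF y]] by (simp add: id_blinfun.rep_eq id_def flip: blinfun_compose.rep_eq)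
    show "continuous (at y) g" using contg y by (simp add: Y_def continuous_on_eq_continuous_at)
  qed (use fg y in \<open>auto simp: Y_def blinfun.bounded_linear_right\<close>)
  have contI: "continuous_on (ball x0 r) I"
    unfolding continuous_on_iff
  proof (intro ballI allI impI)
    fix x and e :: real assume x: "x \<in> ball x0 r" and e: "e > 0"
    have "continuous_on (ball x0 r) D" using cont r continuous_on_subset by blast
    then obtain d where d: "d > 0" "\<And>z. z \<in> ball x0 r \<Longrightarrow> dist z x < d \<Longrightarrow> dist (D z) (D x) < e/4"
      using x e unfolding continuous_on_iff by (metis divide_pos_pos zero_less_numeral)
    have "dist (I z) (I x) < e" if "z \<in> ball x0 r" "dist z x < d" for z
      using blinfun_inverse_lipschitz[of "I z" "D z" "D x" "I x" 2] I[OF x] I[OF that(1)] d(2)[OF that]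
      by (simp add: dist_norm)
    then show "\<exists>d>0. \<forall>z\<in>ball x0 r. dist z x < d \<longrightarrow> dist (I z) (I x) < e" using d by blast
  qed
  have "continuous_on Y (\<lambda>y. I (g y))"
    by (rule continuous_on_compose2[OF contI contg]) (use gX in auto)
  moreover have "\<forall>y\<in>Y. (g has_derivative blinfun_apply (I (g y))) (at y within Y)"
    using derg by (simp add: has_derivative_at_withinI)
  ultimately have "C1_on Y g" unfolding C1_on_def by (intro exI[of _ "\<lambda>y. I (g y)"] conjI)
  moreover have x0: "x0 \<in> X" "f x0 \<in> Y" using r by (auto simp: X_def Y_def)
  moreover have "I x0 = id_blinfun"
    using I[of x0] r(1) D0
    by (metis blinfun_apply_blinfun_compose blinfun_apply_id_blinfun blinfun_eqI centre_in_ball)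
  then have "(g has_derivative (\<lambda>h. h)) (at (f x0))"
    using derg[OF x0(2)] gf[OF x0(1)] by (simp add: id_blinfun.rep_eq)
  ultimately show thesis using that[of X Y g] oX hom r by (auto simp: X_def Y_def)
qed

section \<open>Integrability of deformations\<close>

lemma C1_onE:
  assumes "C1_on U f" "open U"
  obtains D where "\<And>x. x \<in> U \<Longrightarrow> (f has_derivative blinfun_apply (D x)) (at x)"
    "continuous_on U D"
  using assms unfolding C1_on_def by (metis at_within_open)

lemma C1_on_subset:
  assumes "C1_on A f" "B \<subseteq> A"
  shows "C1_on B f"
proof -
  obtain D where D: "\<forall>x\<in>A. (f has_derivative blinfun_apply (D x)) (at x within A)" "continuous_on A D"
    using assms(1) unfolding C1_on_def by blast
  have "\<forall>x\<in>B. (f has_derivative blinfun_apply (D x)) (at x within B)"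
    using D(1) assms(2) by (auto intro: has_derivative_subset)
  moreover have "continuous_on B D" using D(2) assms(2) by (rule continuous_on_subset)
  ultimately show ?thesis unfolding C1_on_def by blast
qed

text \<open>Lyapunov-Schmidt reduction: \<open>G u = p (u - u0) + R (M u)\<close> is a local chart in which the solutions
  of \<open>R (M u) = 0\<close> become the subspace \<open>V0\<close>, because the two summands lie in the complementary
  subspaces \<open>V0\<close> and \<open>V1\<close>. By \<open>est\<close> these solutions solve \<open>M u = 0\<close>. The set \<open>S\<close> has to be the
  solution set only inside \<open>U\<close>, so that \<open>U\<close> may be shrunk to a ball on which \<open>est\<close> is valid.\<close>

lemma integrable_deformations_of_estimate:
  fixes M :: "'v::banach \<Rightarrow> 'w::real_normed_vector"
  assumes U: "open U" "u0 \<in> U" and M0: "M u0 = 0" and ds: "direct_sum_decomp V0 V1"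
    and D: "\<And>u. u \<in> U \<Longrightarrow> (M has_derivative blinfun_apply (D u)) (at u)"
    and contD: "continuous_on U D"
    and p: "bounded_linear (proj_along V0 V1)" and R: "bounded_linear R"
    and RV1: "\<And>w. R w \<in> V1" and RD: "\<And>v. R (D u0 v) = v - proj_along V0 V1 v"
    and est: "\<And>u. u \<in> U \<Longrightarrow> R (M u) = 0 \<Longrightarrow> M u = 0"
    and S: "S \<inter> U = {u \<in> U. M u = 0}"
  shows "integrable_deformations S V0 V1 u0"
proof -
  let ?p = "proj_along V0 V1"
  interpret p: bounded_linear ?p by (rule p)
  interpret R: bounded_linear R by (rule R)
  have V: "subspace V0" "V0 \<inter> V1 = {0}"
    using ds by (auto simp: direct_sum_decomp_def)
  define G where "G u = ?p (u - u0) + R (M u)" for u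
  define DG where "DG u = Blinfun ?p + (Blinfun R o\<^sub>L D u)" for u
  have app: "blinfun_apply (Blinfun ?p) = ?p" "blinfun_apply (Blinfun R) = R"
    using p R by (auto simp: bounded_linear_Blinfun_apply)
  have derG: "(G has_derivative blinfun_apply (DG u)) (at u)" if "u \<in> U" for u
  proof -
    have "(G has_derivative (\<lambda>h. ?p (h - 0) + R (D u h))) (at u)"
      unfolding G_def
      by (intro has_derivative_add p.has_derivative R.has_derivative D that
          has_derivative_diff has_derivative_ident has_derivative_const)
    then show ?thesis
      by (simp add: DG_def blinfun.add_left[abs_def] app)
  qed
  have contDG: "continuous_on U DG"
    unfolding DG_def
    by (intro continuous_intros bounded_bilinear.continuous_on[OF bounded_bilinear_blinfun_compose] contD)
  have DG0: "DG u0 = id_blinfun"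
    by (rule blinfun_eqI) (simp add: DG_def blinfun.add_left app RD)
  have G0: "G u0 = 0" by (simp add: G_def M0 p.zero R.zero)
  obtain X Y g where XY: "open X" "u0 \<in> X" "X \<subseteq> U" "open Y" "0 \<in> Y"
    and hom: "homeomorphism X Y G g" and g: "C1_on Y g" "(g has_derivative (\<lambda>h. h)) (at 0)"
    using C1_inverse_function_near_identity[OF U derG contDG DG0] G0 by metis
  have gX: "g y \<in> X" and Gg: "G (g y) = y" if "y \<in> Y" for y
    using hom that by (auto simp: homeomorphism_def)
  have GY: "G x \<in> Y" and gG: "g (G x) = x" if "x \<in> X" for x
    using hom that by (auto simp: homeomorphism_def)
  have gS: "g y \<in> S" if y: "y \<in> V0 \<inter> Y" for y
  proof -
    have "R (M (g y)) = y - ?p (g y - u0)"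
      using Gg y unfolding G_def by (metis IntD2 add_diff_cancel_left')
    then have "R (M (g y)) \<in> V0 \<inter> V1"
      using y V(1) RV1 proj_along_mem[OF ds] by (metis IntD1 IntI subspace_diff)
    then have "M (g y) = 0" using V(2) est gX y XY(3) by blast
    then show ?thesis using S gX y XY(3) by blast
  qed
  have nhd: "S \<inter> X \<subseteq> g ` (V0 \<inter> Y)"
  proof
    fix u assume u: "u \<in> S \<inter> X"
    then have "M u = 0" using S XY(3) by blast
    then have "G u \<in> V0" using proj_along_mem[OF ds] by (simp add: G_def R.zero)
    then have "G u \<in> V0 \<inter> Y" using GY u by blast
    then show "u \<in> g ` (V0 \<inter> Y)" using gG[of u] u by (metis IntD2 imageI)
  qed
  show ?thesis
    unfolding integrable_deformations_def
  proof (intro exI conjI)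
    show "openin (top_of_set V0) (V0 \<inter> Y)" using XY(4) by (rule openin_open_Int)
    show "0 \<in> V0 \<inter> Y" using V XY by (simp add: subspace_0)
    show "C1_on (V0 \<inter> Y) g" using g(1) by (rule C1_on_subset) simp
    show "g ` (V0 \<inter> Y) \<subseteq> S" using gS by blast
    show "g 0 = u0" using gG[OF XY(2)] G0 by simp
    show "(g has_derivative (\<lambda>h. h)) (at 0 within V0 \<inter> Y)"
      using g(2) by (rule has_derivative_at_withinI)
    show "\<forall>v\<in>V0. ?p v = v" using proj_along_eq_self[OF ds] by blast
    show "openin (top_of_set S) (S \<inter> X)" using XY(1) by (rule openin_open_Int)
    show "u0 \<in> S \<inter> X" using S U M0 XY(2) by blast
    show "S \<inter> X \<subseteq> g ` (V0 \<inter> Y)" by (rule nhd)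
  qed
qed

text \<open>A deformation reaches every small prescribed \<open>V0\<close> coordinate. To see this inside the whole
  space, the map \<open>v \<mapsto> p (\<sigma> v - u0)\<close> on \<open>V0\<close> is completed by the identity on \<open>V1\<close> to the map
  \<open>K\<close>, whose derivative at the origin is the identity, and the inverse function theorem is applied
  to \<open>K\<close>.\<close>

lemma integrable_deformations_solution_over_kernel:
  fixes u0 :: "'v::banach"
  assumes ds: "direct_sum_decomp V0 V1" and p: "bounded_linear (proj_along V0 V1)"
    and int: "integrable_deformations S V0 V1 u0" and e: "\<eta> > 0"
  obtains \<rho> where "\<rho> > 0"
    "\<And>v. v \<in> V0 \<Longrightarrow> norm v < \<rho> \<Longrightarrow> \<exists>s\<in>S. dist s u0 < \<eta> \<and> proj_along V0 V1 (s - u0) = v"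
proof -
  let ?p = "proj_along V0 V1"
  interpret p: bounded_linear ?p by (rule p)
  note pV0 = proj_along_mem[OF ds]
  have pp: "?p (?p x) = ?p x" for x using proj_along_eq_self[OF ds pV0] .
  obtain A \<sigma> d where A: "openin (top_of_set V0) A" "0 \<in> A" and \<sigma>: "C1_on A \<sigma>" "\<sigma> ` A \<subseteq> S"
    "\<sigma> 0 = u0" and d: "(\<sigma> has_derivative d) (at 0 within A)" "\<And>v. v \<in> V0 \<Longrightarrow> ?p (d v) = v"
    using int unfolding integrable_deformations_def by blast
  obtain D where D: "\<And>x. x \<in> A \<Longrightarrow> (\<sigma> has_derivative blinfun_apply (D x)) (at x within A)"
    and contD: "continuous_on A D"
    using \<sigma>(1) unfolding C1_on_def by blast
  obtain Q where Q: "open Q" "A = V0 \<inter> Q" using A(1) by (auto simp: openin_open)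
  define B where "B = ?p -` Q"
  have oB: "open B" unfolding B_def
    using Q(1) p.continuous_on[OF continuous_on_id] by (simp add: open_vimage)
  have pA: "?p x \<in> A" if "x \<in> B" for x using that Q(2) pV0 by (simp add: B_def)
  have B0: "0 \<in> B" using A(2) Q(2) by (simp add: B_def p.zero)
  have der\<sigma>p: "((\<lambda>x. \<sigma> (?p x)) has_derivative (\<lambda>h. l (?p h))) (at x)"
    if x: "x \<in> B" and l: "(\<sigma> has_derivative l) (at (?p x) within A)" for x l
  proof -
    have "((\<lambda>x. \<sigma> (?p x)) has_derivative (\<lambda>h. l (?p h))) (at x within B)"
    proof (rule has_derivative_in_compose[where f="?p" and f'="?p" and g=\<sigma> and g'=l])
      show "(?p has_derivative ?p) (at x within B)"
        by (rule bounded_linear_imp_has_derivative[OF p])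
      show "(\<sigma> has_derivative l) (at (?p x) within ?p ` B)"
        by (rule has_derivative_subset[OF l]) (use pA in blast)
    qed
    then show ?thesis unfolding at_within_open[OF x oB] .
  qed
  \<comment> \<open>derivatives within \<open>A\<close> are determined only on \<open>V0\<close>; composing with the projection gives
    derivatives at an interior point, where uniqueness holds\<close>
  have D0: "D 0 (?p h) = d (?p h)" for h
  proof -
    have "(\<lambda>h. D 0 (?p h)) = (\<lambda>h. d (?p h))"
      using der\<sigma>p[OF B0, of "D 0"] der\<sigma>p[OF B0, of d] D[OF A(2)] d(1)
      by (intro has_derivative_unique) (auto simp: p.zero)
    then show ?thesis by (rule fun_cong)
  qed
  define C where "C = B \<inter> (\<lambda>x. \<sigma> (?p x)) -` ball u0 \<eta>"
  have oC: "open C"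
    unfolding C_def
  proof (intro continuous_open_preimage continuous_at_imp_continuous_on ballI oB open_ball)
    show "isCont (\<lambda>x. \<sigma> (?p x)) x" if "x \<in> B" for x
      using der\<sigma>p[OF that D[OF pA[OF that]]] by (rule has_derivative_continuous)
  qed
  have C0: "0 \<in> C" using B0 e \<sigma>(3) by (simp add: C_def p.zero)
  define K where "K x = ?p (\<sigma> (?p x) - u0) + (x - ?p x)" for x
  define DK where "DK x = (Blinfun ?p o\<^sub>L (D (?p x) o\<^sub>L Blinfun ?p)) + (id_blinfun - Blinfun ?p)" for x
  have app: "blinfun_apply (Blinfun ?p) = ?p" using p by (rule bounded_linear_Blinfun_apply)
  have derK: "(K has_derivative blinfun_apply (DK x)) (at x)" if "x \<in> C" for x
  proof -
    have x: "x \<in> B" using that by (simp add: C_def)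
    have "(K has_derivative (\<lambda>h. ?p (D (?p x) (?p h) - 0) + (h - ?p h))) (at x)"
      unfolding K_def
      by (intro has_derivative_add p.has_derivative der\<sigma>p[OF x D[OF pA[OF x]]]
          has_derivative_diff has_derivative_ident has_derivative_const)
    then show ?thesis
      by (simp add: DK_def blinfun.add_left[abs_def] blinfun.diff_left[abs_def] app)
  qed
  have "continuous_on C (\<lambda>x. D (?p x))"
    using pA by (intro continuous_on_compose2[OF contD] p.continuous_on continuous_on_id)
      (auto simp: C_def)
  then have contDK: "continuous_on C DK"
    unfolding DK_def
    by (intro continuous_intros bounded_bilinear.continuous_on[OF bounded_bilinear_blinfun_compose])
  have DK0: "DK 0 = id_blinfun"
    by (rule blinfun_eqI)
      (simp add: DK_def blinfun.add_left blinfun.diff_left app p.zero D0 d(2) pV0)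
  have K0: "K 0 = 0" by (simp add: K_def p.zero \<sigma>(3))
  obtain X Y g where XY: "X \<subseteq> C" "open Y" "0 \<in> Y" and hom: "homeomorphism X Y K g"
    using C1_inverse_function_near_identity[OF oC C0 derK contDK DK0] K0 by metis
  obtain \<rho> where \<rho>: "\<rho> > 0" "ball 0 \<rho> \<subseteq> Y" using XY open_contains_ball by blast
  have "\<exists>s\<in>S. dist s u0 < \<eta> \<and> ?p (s - u0) = v" if v: "v \<in> V0" "norm v < \<rho>" for v
  proof -
    have "v \<in> Y" using v \<rho> by auto
    then obtain x where x: "x \<in> C" "K x = v"
      using hom XY(1) unfolding homeomorphism_def by blast
    have "v = ?p (K x)" using x proj_along_eq_self[OF ds v(1)] by simp
    also have "\<dots> = ?p (\<sigma> (?p x) - u0)" by (simp add: K_def p.add p.diff pp)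
    finally have "?p (\<sigma> (?p x) - u0) = v" by simp
    moreover have "\<sigma> (?p x) \<in> S" using x pA \<sigma>(2) by (auto simp: C_def)
    moreover have "dist (\<sigma> (?p x)) u0 < \<eta>" using x by (simp add: C_def dist_commute)
    ultimately show ?thesis by blast
  qed
  with \<rho>(1) show thesis by (rule that)
qed

text \<open>A point \<open>u\<close> is compared with a solution \<open>s\<close> having the same \<open>V0\<close> coordinate. Along the
  difference \<open>u - s\<close>, which lies in \<open>V1\<close>, the derivative is bounded below through \<open>R\<close>, whereas its
  composition with \<open>q\<close> vanishes; strict differentiability carries both facts over to \<open>M\<close>.\<close>

lemma estimate_of_integrable_deformations:
  fixes M :: "'v::banach \<Rightarrow> 'w::real_normed_vector" and q :: "'w \<Rightarrow> 'w"
  assumes U: "open U" "u0 \<in> U" and ds: "direct_sum_decomp V0 V1"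
    and D: "\<And>u. u \<in> U \<Longrightarrow> (M has_derivative blinfun_apply (D u)) (at u)"
    and contD: "continuous_on U D"
    and p: "bounded_linear (proj_along V0 V1)" and R: "bounded_linear R" and q: "bounded_linear q"
    and qD: "\<And>v. q (D u0 v) = 0" and RD: "\<And>v. R (D u0 v) = v - proj_along V0 V1 v"
    and int: "integrable_deformations {u \<in> U. M u = 0} V0 V1 u0" and e: "\<epsilon> > 0"
  obtains \<delta> where "\<delta> > 0" "ball u0 \<delta> \<subseteq> U"
    "\<And>u. u \<in> ball u0 \<delta> \<Longrightarrow> norm (q (M u)) \<le> \<epsilon> * norm (M u)"
proof -
  let ?p = "proj_along V0 V1"
  interpret p: bounded_linear ?p by (rule p)
  interpret q: bounded_linear q by (rule q)
  obtain a where a: "a > 0" "\<And>v. norm (?p v) \<le> norm v * a" using p.pos_bounded by blast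
  obtain b where b: "b > 0" "\<And>w. norm (q w) \<le> norm w * b" using q.pos_bounded by blast
  obtain c where c: "c > 0" "\<And>w. norm (R w) \<le> norm w * c"
    using bounded_linear.pos_bounded[OF R] by blast
  \<comment> \<open>the first bound absorbs the linearization error into \<open>u - s\<close>, the second yields the factor \<open>\<epsilon>\<close>\<close>
  define \<theta> where "\<theta> = min (1 / (2 * c)) (\<epsilon> / (2 * b * c))"
  have \<theta>: "\<theta> > 0" "c * \<theta> \<le> 1/2" "2 * b * c * \<theta> \<le> \<epsilon>"
  proof -
    show "\<theta> > 0" using b c e by (simp add: \<theta>_def)
    have "c * \<theta> \<le> c * (1 / (2 * c))" using c by (intro mult_left_mono) (auto simp: \<theta>_def)
    then show "c * \<theta> \<le> 1/2" using c by simp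
    have "2 * b * c * \<theta> \<le> 2 * b * c * (\<epsilon> / (2 * b * c))"
      using b c by (intro mult_left_mono) (auto simp: \<theta>_def)
    then show "2 * b * c * \<theta> \<le> \<epsilon>" using b c by simp
  qed
  obtain \<eta> where \<eta>: "\<eta> > 0" "ball u0 \<eta> \<subseteq> U" and strict: "\<And>x y. x \<in> ball u0 \<eta> \<Longrightarrow> y \<in> ball u0 \<eta> \<Longrightarrow>
      norm (M x - M y - D u0 (x - y)) \<le> \<theta> * norm (x - y)"
    using C1_on_strict_derivative[OF U D contD \<theta>(1)] by metis
  obtain \<rho> where \<rho>: "\<rho> > 0" and lift: "\<And>v. v \<in> V0 \<Longrightarrow> norm v < \<rho> \<Longrightarrow>
      \<exists>s\<in>{u \<in> U. M u = 0}. dist s u0 < \<eta> \<and> ?p (s - u0) = v"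
    using integrable_deformations_solution_over_kernel[OF ds p int \<eta>(1)] by blast
  define \<delta> where "\<delta> = min \<eta> (\<rho> / a)"
  have "norm (q (M u)) \<le> \<epsilon> * norm (M u)" if u: "u \<in> ball u0 \<delta>" for u
  proof -
    have "norm (?p (u - u0)) \<le> norm (u - u0) * a" by (rule a)
    also have "\<dots> < \<rho>"
      using u a(1) by (simp add: \<delta>_def dist_norm norm_minus_commute pos_less_divide_eq)
    finally obtain s where s: "M s = 0" "dist s u0 < \<eta>" "?p (s - u0) = ?p (u - u0)"
      using lift proj_along_mem[OF ds] by blast
    have "?p (u - s) = 0" using s(3) by (simp add: p.diff)
    then have inv: "R (D u0 (u - s)) = u - s" using RD by simp
    have st: "norm (M u - D u0 (u - s)) \<le> \<theta> * norm (u - s)"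
      using strict[of u s] u s by (simp add: \<delta>_def dist_commute)
    have "norm (u - s) \<le> norm (D u0 (u - s)) * c"
      using c(2)[of "D u0 (u - s)"] inv by simp
    also have "\<dots> \<le> (norm (M u) + \<theta> * norm (u - s)) * c"
      using st c(1) norm_triangle_ineq4[of "M u" "M u - D u0 (u - s)"]
      by (intro mult_right_mono) auto
    also have "\<dots> = c * norm (M u) + c * \<theta> * norm (u - s)" by (simp add: algebra_simps)
    also have "\<dots> \<le> c * norm (M u) + 1/2 * norm (u - s)"
      using \<theta>(2) by (intro add_left_mono mult_right_mono) auto
    finally have us: "norm (u - s) \<le> 2 * c * norm (M u)" by simp
    have "norm (q (M u)) = norm (q (M u - D u0 (u - s)))" by (simp add: q.diff qD)
    also have "\<dots> \<le> norm (M u - D u0 (u - s)) * b" by (rule b)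
    also have "\<dots> \<le> (\<theta> * (2 * c * norm (M u))) * b"
      using st us \<theta>(1) b(1)
      by (intro mult_right_mono order_trans[OF st] mult_left_mono) auto
    also have "\<dots> = (2 * b * c * \<theta>) * norm (M u)" by (simp add: mult_ac)
    also have "\<dots> \<le> \<epsilon> * norm (M u)" using \<theta>(3) by (intro mult_right_mono) auto
    finally show ?thesis .
  qed
  moreover have "\<delta> > 0" "ball u0 \<delta> \<subseteq> U" using \<eta> \<rho> a(1) by (auto simp: \<delta>_def)
  ultimately show thesis using that by blast
qed

theorem lemma2p2:
  fixes M :: "'v::banach \<Rightarrow> 'w::banach"
    and U :: "'v set" and u0 :: 'v and L :: "'v \<Rightarrow> 'w"
    and V0 V1 :: "'v set" and W0 W1 :: "'w set"
  assumes "open U" and "C1_on U M" and "u0 \<in> U" and "M u0 = 0"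
    and "(M has_derivative L) (at u0)"
    and "V0 = {v. L v = 0}"
    and "closed V1" and "direct_sum_decomp V0 V1"
    and "W1 = range L" and "closed W1"
    and "closed W0" and "direct_sum_decomp W0 W1"
  shows "integrable_deformations {u \<in> U. M u = 0} V0 V1 u0 \<longleftrightarrow>
    (\<forall>\<epsilon>>0. \<exists>\<delta>>0. ball u0 \<delta> \<subseteq> U \<and>
       (\<forall>u\<in>ball u0 \<delta>. norm (proj_along W0 W1 (M u)) \<le> \<epsilon> * norm (M u)))"
proof -
  obtain D where D: "\<And>u. u \<in> U \<Longrightarrow> (M has_derivative blinfun_apply (D u)) (at u)"
    and contD: "continuous_on U D"
    using C1_onE[OF \<open>C1_on U M\<close> \<open>open U\<close>] by blast
  have D0: "blinfun_apply (D u0) = L"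
    using D[OF \<open>u0 \<in> U\<close>] \<open>(M has_derivative L) (at u0)\<close> by (rule has_derivative_unique)
  have L: "bounded_linear L" using assms(5) by (rule has_derivative_bounded_linear)
  have "closed V0"
    unfolding assms(6) using L
    by (intro closed_Collect_eq linear_continuous_on continuous_on_const)
  then have p: "bounded_linear (proj_along V0 V1)"
    using assms by (intro bounded_linear_proj_along)
  have q: "bounded_linear (proj_along W0 W1)"
    using assms by (intro bounded_linear_proj_along)
  interpret L: bounded_linear L by (rule L)
  obtain R where R: "bounded_linear R" "\<And>w. R w \<in> V1" "\<And>w. L (R w) = w - proj_along W0 W1 w"
    "\<And>v. R (L v) = v - proj_along V0 V1 v"
    using bounded_partial_inverse[OF L \<open>closed V1\<close>] assms(6,8-12) by metis
  have qL: "proj_along W0 W1 (L v) = 0" for v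
    using proj_along_eq_0_iff[OF assms(12)] assms(9) by blast
  show ?thesis
  proof (intro iffI allI impI)
    fix \<epsilon> :: real
    assume "integrable_deformations {u \<in> U. M u = 0} V0 V1 u0" "\<epsilon> > 0"
    then show "\<exists>\<delta>>0. ball u0 \<delta> \<subseteq> U \<and>
        (\<forall>u\<in>ball u0 \<delta>. norm (proj_along W0 W1 (M u)) \<le> \<epsilon> * norm (M u))"
      using estimate_of_integrable_deformations[OF \<open>open U\<close> \<open>u0 \<in> U\<close> assms(8) D contD p R(1) q]
      unfolding D0 using qL R(4) by metis
  next
    assume *: "\<forall>\<epsilon>>0. \<exists>\<delta>>0. ball u0 \<delta> \<subseteq> U \<and>
       (\<forall>u\<in>ball u0 \<delta>. norm (proj_along W0 W1 (M u)) \<le> \<epsilon> * norm (M u))"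
    obtain \<delta> where \<delta>: "\<delta> > 0" "ball u0 \<delta> \<subseteq> U"
      "\<And>u. u \<in> ball u0 \<delta> \<Longrightarrow> norm (proj_along W0 W1 (M u)) \<le> 1/2 * norm (M u)"
      using *[rule_format, of "1/2"] by auto
    show "integrable_deformations {u \<in> U. M u = 0} V0 V1 u0"
    proof (rule integrable_deformations_of_estimate[where U="ball u0 \<delta>" and D=D and R=R])
      fix u assume u: "u \<in> ball u0 \<delta>" "R (M u) = 0"
      have "M u = proj_along W0 W1 (M u)" using R(3)[of "M u"] u(2) by (simp add: L.zero)
      then show "M u = 0" using \<delta>(3)[OF u(1)] by simp
    next
      show "continuous_on (ball u0 \<delta>) D" using contD \<delta>(2) by (rule continuous_on_subset)
    qed (use \<delta> D D0 R p assms in auto)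
  qed
qed

end
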